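(* The class of $\omega$-languages recognized by deterministic reachability Parikh automata is a strict subclass of the class of $\omega$-languages recognized by deterministic reachability-regular Parikh automata.
   Context: $\mathbb{N}=\{0,1,2,\dots\}$. A linear set is a set $C(\mathbf{b},P)=\{\mathbf{b}+\mathbf{p}_1z_1+\dots+\mathbf{p}_\ell z_\ell \mid z_1,\dots,z_\ell\in\mathbb{N}\}\subseteq\mathbb{N}^d$ with $\mathbf{b}\in\mathbb{N}^d$ and $P=\{\mathbf{p}_1,\dots,\mathbf{p}_\ell\}\subseteq\mathbb{N}^d$ finite ($\ell\ge 0$); a semi-linear set is a finite union of linear sets. A Parikh automaton (PA) of dimension $d\ge 1$ is a tuple $\mathcal{A}=(Q,\Sigma,q_0,\Delta,F,C)$ with a finite state set $Q$, a finite non-empty alphabet $\Sigma$, an initial state $q_0\in Q$, a finite set of labeled transitions $\Delta\subseteq Q\times\Sigma\times\mathbb{N}^d\times Q$, a set of accepting states $F\subseteq Q$, and a semi-linear set $C\subseteq\mathbb{N}^d$. It is deterministic if for every $(p,a)\in Q\times\Sigma$ there is exactly one transition $(p,a,\mathbf{v},q)\in\Delta$. A run on $\alpha=\alpha_1\alpha_2\dots\in\Sigma^\omega$ is an infinite sequence $r=r_1r_2\dots$ with $r_i=(p_{i-1},\alpha_i,\mathbf{v}_i,p_i)\in\Delta$ and $p_0=q_0$; write $\rho(r_m\dots r_n)=\sum_{i=m}^n\mathbf{v}_i$. Acceptance of a run $r$: - Reachability PA: there is $i\ge 1$ with $p_i\in F$ and $\rho(r_1\dots r_i)\in C$. - Reachability-regular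 PA: there is $i\ge 1$ with $p_i\in F$ and $\rho(r_1\dots r_i)\in C$, and there are infinitely many $j\ge 1$ with $p_j\in F$. In each case the recognized $\omega$-language is the set of all $\alpha\in\Sigma^\omega$ on which there is an accepting run. *)

theory Defs
  imports "HOL-Library.Omega_Words_Fun" "HOL-Library.Infinite_Typeclass"
begin

text \<open>
  The dimension of a Parikh automaton is existentially quantified in the language classes below,
  so vectors of dimension \<open>d\<close> are functions on all of \<^typ>\<open>nat\<close> whose components at indices
  \<open>\<ge> d\<close> are zero. This makes equality of vectors coincide with equality of functions.
\<close>

type_synonym nvec = "nat \<Rightarrow> nat"

definition nvecs :: "nat \<Rightarrow> nvec set" where
  "nvecs d = {x. \<forall>i\<ge>d. x i = 0}"

definition linear_set :: "nvec \<Rightarrow> nvec set \<Rightarrow> nvec set" where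
  "linear_set b P = {x. \<exists>z :: nvec \<Rightarrow> nat. x = (\<lambda>i. b i + (\<Sum>p\<in>P. p i * z p))}"

definition semilinear :: "nat \<Rightarrow> nvec set \<Rightarrow> bool" where
  "semilinear d C \<longleftrightarrow>
     (\<exists>G :: (nvec \<times> nvec set) set. finite G \<and>
        (\<forall>(b, P)\<in>G. b \<in> nvecs d \<and> finite P \<and> P \<subseteq> nvecs d) \<and>
        C = (\<Union>(b, P)\<in>G. linear_set b P))"

record ('q, 'a) parikh_automaton =
  dim :: nat
  states :: "'q set"
  alphabet :: "'a set"
  initial :: 'q
  transitions :: "('q \<times> 'a \<times> nvec \<times> 'q) set"
  accepting :: "'q set"
  constraint_set :: "nvec set"

definition is_PA :: "('q, 'a) parikh_automaton \<Rightarrow> bool" where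
  "is_PA A \<longleftrightarrow>
     dim A \<ge> 1 \<and>
     finite (states A) \<and>
     finite (alphabet A) \<and> alphabet A \<noteq> {} \<and>
     initial A \<in> states A \<and>
     finite (transitions A) \<and>
     transitions A \<subseteq> states A \<times> alphabet A \<times> nvecs (dim A) \<times> states A \<and>
     accepting A \<subseteq> states A \<and>
     semilinear (dim A) (constraint_set A)"

definition deterministic :: "('q, 'a) parikh_automaton \<Rightarrow> bool" where
  "deterministic A \<longleftrightarrow>
     (\<forall>p\<in>states A. \<forall>a\<in>alphabet A. \<exists>!vq. (p, a, vq) \<in> transitions A)"

text \<open>
  Words are indexed from 0. A run \<open>r\<^sub>1 r\<^sub>2 \<dots>\<close> with \<open>r\<^sub>i = (p\<^sub>i\<^sub>-\<^sub>1, \<alpha>\<^sub>i, v\<^sub>i, p\<^sub>i)\<close> is represented by its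
  state sequence \<open>p\<close> and its vector sequence \<open>v\<close>, where \<open>p i\<close> is the state after \<open>i\<close> transitions
  and the transition number \<open>i\<close> (counted from 1) reads \<open>\<alpha> (i - 1)\<close> and contributes \<open>v (i - 1)\<close>.
  Hence \<open>parikh_sum v i\<close> is the sum \<open>\<rho>(r\<^sub>1 \<dots> r\<^sub>i)\<close> of the first \<open>i\<close> vectors.
\<close>

definition is_run ::
    "('q, 'a) parikh_automaton \<Rightarrow> 'a word \<Rightarrow> (nat \<Rightarrow> 'q) \<Rightarrow> (nat \<Rightarrow> nvec) \<Rightarrow> bool" where
  "is_run A \<alpha> p v \<longleftrightarrow>
     p 0 = initial A \<and> (\<forall>i. (p i, \<alpha> i, v i, p (Suc i)) \<in> transitions A)"

definition parikh_sum :: "(nat \<Rightarrow> nvec) \<Rightarrow> nat \<Rightarrow> nvec" where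
  "parikh_sum v i = (\<lambda>j. \<Sum>k<i. v k j)"

definition reach_acc ::
    "('q, 'a) parikh_automaton \<Rightarrow> (nat \<Rightarrow> 'q) \<Rightarrow> (nat \<Rightarrow> nvec) \<Rightarrow> bool" where
  "reach_acc A p v \<longleftrightarrow> (\<exists>i\<ge>1. p i \<in> accepting A \<and> parikh_sum v i \<in> constraint_set A)"

definition reach_reg_acc ::
    "('q, 'a) parikh_automaton \<Rightarrow> (nat \<Rightarrow> 'q) \<Rightarrow> (nat \<Rightarrow> nvec) \<Rightarrow> bool" where
  "reach_reg_acc A p v \<longleftrightarrow>
     (\<exists>i\<ge>1. p i \<in> accepting A \<and> parikh_sum v i \<in> constraint_set A) \<and>
     infinite {j. j \<ge> 1 \<and> p j \<in> accepting A}"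

definition reach_lang :: "('q, 'a) parikh_automaton \<Rightarrow> 'a word set" where
  "reach_lang A = {\<alpha>. range \<alpha> \<subseteq> alphabet A \<and> (\<exists>p v. is_run A \<alpha> p v \<and> reach_acc A p v)}"

definition reach_reg_lang :: "('q, 'a) parikh_automaton \<Rightarrow> 'a word set" where
  "reach_reg_lang A =
     {\<alpha>. range \<alpha> \<subseteq> alphabet A \<and> (\<exists>p v. is_run A \<alpha> p v \<and> reach_reg_acc A p v)}"

text \<open>
  An \<open>\<omega>\<close>-language is paired with the alphabet it is considered over, so that comparing two classes
  compares the languages recognized over the same alphabet. Alphabets are arbitrary finite
  non-empty sets of letters of type \<^typ>\<open>'a\<close>. Taking natural numbers as states is no restriction,
  because state sets are finite and recognition is invariant under renaming states.
\<close>

definition det_reach_languages :: "('a set \<times> 'a word set) set" where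
  "det_reach_languages =
     {(alphabet A, reach_lang A) | A :: (nat, 'a) parikh_automaton. is_PA A \<and> deterministic A}"

definition det_reach_reg_languages :: "('a set \<times> 'a word set) set" where
  "det_reach_reg_languages =
     {(alphabet A, reach_reg_lang A) | A :: (nat, 'a) parikh_automaton. is_PA A \<and> deterministic A}"

end

(*
  Inclusion: declare every state accepting, so that the regularity condition becomes vacuous, and
  record membership of the current state in the old accepting set as the parity of one additional
  counter, which counts how often a run enters or leaves that set. The parity test is semilinear.

  Strictness: acceptance of a reachability automaton is decided by a finite prefix, and a
  deterministic automaton has a run on every continuation of that prefix. Hence a deterministic
  reachability automaton that accepts x x x ... also accepts x ... x y y y ..., so it cannot
  recognize the words with infinitely many x.
*)

theory Submission
  imports Defs
begin

section \<open>Semilinear sets with a parity condition on an additional coordinate\<close>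

lemma nvecs_SucI:
  assumes "x(d := 0) \<in> nvecs d"
  shows "x \<in> nvecs (Suc d)"
  unfolding nvecs_def
proof (intro CollectI allI impI)
  fix i assume "i \<ge> Suc d"
  then have "i \<ge> d" "i \<noteq> d"
    by simp_all
  with assms show "x i = 0"
    by (auto simp: nvecs_def)
qed

text \<open>Coordinate \<open>d\<close> decouples from the others: \<open>b\<close> and all of
  \<open>P\<close> vanish there, while the new period vanishes elsewhere. The period is positive at
  \<open>d\<close>, hence not in \<open>P\<close>, so its coefficient can be chosen freely.\<close>

lemma linear_set_insert_period:
  assumes b: "b \<in> nvecs d" and P: "finite P" "P \<subseteq> nvecs d"
  shows "linear_set (b(d := r)) (insert (\<lambda>i. if i = d then Suc m else 0) P) =
    {x. x(d := 0) \<in> linear_set b P \<and> (\<exists>n. x d = r + Suc m * n)}"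
    (is "linear_set _ (insert ?e P) = ?R")
proof -
  have bd: "b d = 0"
    using b by (simp add: nvecs_def)
  have Pd: "p d = 0" if "p \<in> P" for p
    using that P(2) by (auto simp: nvecs_def)
  then have sum_d: "(\<Sum>p\<in>P. p d * z p) = 0" for z
    by (intro sum.neutral) simp
  have e: "?e \<notin> P"
    using Pd[of ?e] by auto
  have sum_insert: "(\<Sum>p\<in>insert ?e P. p i * z p) = ?e i * z ?e + (\<Sum>p\<in>P. p i * z p)"
    for z i using e P(1) by simp
  show ?thesis
  proof (intro set_eqI iffI)
    fix x assume "x \<in> linear_set (b(d := r)) (insert ?e P)"
    then obtain z where x: "x = (\<lambda>i. (b(d := r)) i + (\<Sum>p\<in>insert ?e P. p i * z p))"
      unfolding linear_set_def by blast
    have "x(d := 0) = (\<lambda>i. b i + (\<Sum>p\<in>P. p i * z p))"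
      unfolding x sum_insert using bd sum_d by (auto simp: fun_eq_iff)
    moreover have "x d = r + Suc m * z ?e"
      unfolding x sum_insert using sum_d by simp
    ultimately show "x \<in> ?R"
      unfolding linear_set_def by blast
  next
    fix x assume "x \<in> ?R"
    then obtain z n where z: "x(d := 0) = (\<lambda>i. b i + (\<Sum>p\<in>P. p i * z p))"
      and n: "x d = r + Suc m * n"
      unfolding linear_set_def by blast
    let ?z = "z(?e := n)"
    have same: "(\<Sum>p\<in>P. p i * ?z p) = (\<Sum>p\<in>P. p i * z p)" for i
      using e by (intro sum.cong) auto
    have "x i = (b(d := r)) i + (\<Sum>p\<in>insert ?e P. p i * ?z p)" for i
      unfolding sum_insert same using n sum_d fun_cong[OF z, of i] by (cases "i = d") auto
    then show "x \<in> linear_set (b(d := r)) (insert ?e P)"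
      unfolding linear_set_def by blast
  qed
qed

text \<open>A prescribed parity is a residue class modulo 2, so each linear component of
  \<open>C\<close> can be extended separately by a base value and a period in coordinate
  \<open>d\<close>.\<close>

lemma semilinear_parity:
  assumes "semilinear d C"
  shows "semilinear (Suc d) {x. x(d := 0) \<in> C \<and> (odd (x d) \<longleftrightarrow> s)}"
proof -
  obtain G where G: "finite G" "\<forall>(b, P)\<in>G. b \<in> nvecs d \<and> finite P \<and> P \<subseteq> nvecs d"
    and C: "C = (\<Union>(b, P)\<in>G. linear_set b P)"
    using assms unfolding semilinear_def by blast
  \<comment> \<open>The least number of the prescribed parity; the period below is 2, written as
    \<open>Suc 1\<close> to match \<open>Suc m\<close>.\<close>
  define r :: nat where "r = of_bool s"
  define e where "e = (\<lambda>i. if i = d then Suc 1 else 0)"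
  let ?G = "(\<lambda>(b, P). (b(d := r), insert e P)) ` G"
  have parity: "(\<exists>n. k = r + Suc 1 * n) \<longleftrightarrow> (odd k \<longleftrightarrow> s)" for k
    unfolding r_def by (cases s; simp; presburger)
  have lin: "linear_set (b(d := r)) (insert e P) =
      {x. x(d := 0) \<in> linear_set b P \<and> (odd (x d) \<longleftrightarrow> s)}" if "(b, P) \<in> G" for b P
    unfolding e_def using that G(2) linear_set_insert_period[of b d P r 1] parity by auto
  have "\<forall>(b, P)\<in>?G. b \<in> nvecs (Suc d) \<and> finite P \<and> P \<subseteq> nvecs (Suc d)"
    using G(2) by (fastforce simp: nvecs_def e_def)
  moreover have "{x. x(d := 0) \<in> C \<and> (odd (x d) \<longleftrightarrow> s)} = (\<Union>(b, P)\<in>?G. linear_set b P)"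
    using lin unfolding C by (fastforce simp: image_iff)
  ultimately show ?thesis
    unfolding semilinear_def using G(1) by (intro exI[of _ ?G]) auto
qed

section \<open>The parity automaton and its language\<close>

text \<open>Index \<open>dim A\<close> is the first one at which all old vectors vanish. It counts
  the transitions that cross the boundary of \<open>accepting A\<close>; an odd count means that the
  current state and the initial state lie on different sides. The parity required by the constraint
  set thus says that the current state is accepting in \<open>A\<close>.\<close>

definition parity_PA :: "('q, 'a) parikh_automaton \<Rightarrow> ('q, 'a) parikh_automaton" where
  "parity_PA A = A\<lparr>
     dim := Suc (dim A),
     transitions := (\<lambda>(p, a, v, q).
       (p, a, v(dim A := of_bool ((p \<in> accepting A) \<noteq> (q \<in> accepting A))), q)) ` transitions A,
     accepting := states A,
     constraint_set := {x. x(dim A := 0) \<in> constraint_set A \<and>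
       (odd (x (dim A)) \<longleftrightarrow> initial A \<notin> accepting A)}\<rparr>"

lemma parity_PA_simps [simp]:
  "dim (parity_PA A) = Suc (dim A)"
  "states (parity_PA A) = states A"
  "alphabet (parity_PA A) = alphabet A"
  "initial (parity_PA A) = initial A"
  "accepting (parity_PA A) = states A"
  by (simp_all add: parity_PA_def)

text \<open>Old vectors vanish at \<open>dim A\<close>, so resetting that coordinate recovers the
  original transition.\<close>

lemma transitions_parity_PA:
  assumes "is_PA A"
  shows "(p, a, w, q) \<in> transitions (parity_PA A) \<longleftrightarrow>
    (p, a, w(dim A := 0), q) \<in> transitions A \<and>
    w (dim A) = of_bool ((p \<in> accepting A) \<noteq> (q \<in> accepting A))"
proof -
  have zero: "v(dim A := 0) = v" if "(p, a, v, q) \<in> transitions A" for v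
    using assms that by (fastforce simp: is_PA_def nvecs_def fun_eq_iff)
  let ?m = "of_bool ((p \<in> accepting A) \<noteq> (q \<in> accepting A)) :: nat"
  have "(p, a, w, q) \<in> transitions (parity_PA A) \<longleftrightarrow>
      (\<exists>v. (p, a, v, q) \<in> transitions A \<and> w = v(dim A := ?m))"
    unfolding parity_PA_def by (auto simp: image_iff Bex_def)
  also have "\<dots> \<longleftrightarrow> (p, a, w(dim A := 0), q) \<in> transitions A \<and> w (dim A) = ?m"
  proof
    assume "\<exists>v. (p, a, v, q) \<in> transitions A \<and> w = v(dim A := ?m)"
    then obtain v where v: "(p, a, v, q) \<in> transitions A" "w = v(dim A := ?m)"
      by blast
    then have "w(dim A := 0) = v"
      using zero by simp
    with v show "(p, a, w(dim A := 0), q) \<in> transitions A \<and> w (dim A) = ?m"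
      by simp
  next
    assume "(p, a, w(dim A := 0), q) \<in> transitions A \<and> w (dim A) = ?m"
    moreover from this have "w = (w(dim A := 0))(dim A := ?m)"
      by (metis fun_upd_triv fun_upd_upd)
    ultimately show "\<exists>v. (p, a, v, q) \<in> transitions A \<and> w = v(dim A := ?m)"
      by blast
  qed
  finally show ?thesis .
qed

lemma is_PA_parity_PA:
  assumes "is_PA A"
  shows "is_PA (parity_PA A)"
proof -
  have "transitions (parity_PA A)
      \<subseteq> states A \<times> alphabet A \<times> nvecs (Suc (dim A)) \<times> states A"
    using assms by (fastforce simp: transitions_parity_PA is_PA_def intro!: nvecs_SucI)
  moreover have "finite (transitions (parity_PA A))"
    using assms by (simp add: parity_PA_def is_PA_def)
  moreover have "semilinear (Suc (dim A)) (constraint_set (parity_PA A))"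
    using assms semilinear_parity[of "dim A" "constraint_set A" "initial A \<notin> accepting A"]
    by (simp add: parity_PA_def is_PA_def)
  ultimately show ?thesis
    using assms by (simp add: is_PA_def)
qed

text \<open>The added component is a function of the two end states, so a unique transition stays
  unique.\<close>

lemma deterministic_parity_PA:
  assumes "is_PA A" "deterministic A"
  shows "deterministic (parity_PA A)"
  unfolding deterministic_def
proof (intro ballI)
  fix p a assume "p \<in> states (parity_PA A)" "a \<in> alphabet (parity_PA A)"
  then have "\<exists>!vq. (p, a, vq) \<in> transitions A"
    using assms(2) by (simp add: deterministic_def)
  then obtain v q where vq: "(p, a, v, q) \<in> transitions A"
    and uniq: "\<And>v' q'. (p, a, v', q') \<in> transitions A \<Longrightarrow> v' = v \<and> q' = q"
    by auto
  let ?w = "v(dim A := of_bool ((p \<in> accepting A) \<noteq> (q \<in> accepting A)))"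
  show "\<exists>!vq. (p, a, vq) \<in> transitions (parity_PA A)"
  proof (intro ex1I)
    show "(p, a, ?w, q) \<in> transitions (parity_PA A)"
      using vq unfolding parity_PA_def by force
  next
    fix wq' assume "(p, a, wq') \<in> transitions (parity_PA A)"
    then show "wq' = (?w, q)"
      unfolding parity_PA_def by (auto dest!: uniq)
  qed
qed

lemma run_states:
  assumes "is_PA A" "is_run A \<alpha> p v"
  shows "p i \<in> states A"
  using assms by (cases i) (auto simp: is_PA_def is_run_def)

lemma is_run_parity_PA:
  assumes "is_PA A"
  shows "is_run (parity_PA A) \<alpha> p w \<longleftrightarrow>
    is_run A \<alpha> p (\<lambda>i. (w i)(dim A := 0)) \<and>
    (\<forall>i. w i (dim A) = of_bool ((p i \<in> accepting A) \<noteq> (p (Suc i) \<in> accepting A)))"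
  by (auto simp: is_run_def transitions_parity_PA[OF assms])

text \<open>Telescoping modulo 2: each change flips the truth value.\<close>

lemma odd_sum_changes:
  fixes P :: "nat \<Rightarrow> bool"
  shows "odd (\<Sum>k<i. of_bool (P k \<noteq> P (Suc k)) :: nat) \<longleftrightarrow> P 0 \<noteq> P i"
proof (induction i)
  case (Suc i)
  then show ?case
    unfolding sum.lessThan_Suc even_add by auto
qed simp

text \<open>A run never leaves \<open>states A\<close>, so it is accepting infinitely often. The
  same index witnesses reachability on both sides, because the parity test there amounts to
  membership in \<open>accepting A\<close>.\<close>

lemma reach_reg_acc_parity_PA:
  assumes "is_PA A" "is_run (parity_PA A) \<alpha> p w"
  shows "reach_reg_acc (parity_PA A) p w \<longleftrightarrow> reach_acc A p (\<lambda>i. (w i)(dim A := 0))"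
proof -
  have p: "p i \<in> states A" for i
    using run_states[OF is_PA_parity_PA] assms by fastforce
  have "{j. j \<ge> 1 \<and> p j \<in> states A} = {1..}"
    using p by auto
  then have "infinite {j. j \<ge> 1 \<and> p j \<in> states A}"
    by (simp add: infinite_Ici)
  moreover have "odd (parikh_sum w i (dim A)) \<longleftrightarrow> (p 0 \<in> accepting A) \<noteq> (p i \<in> accepting A)" for i
    using assms odd_sum_changes[of "\<lambda>i. p i \<in> accepting A" i]
    by (simp add: is_run_parity_PA parikh_sum_def)
  moreover have "p 0 = initial A"
    using assms by (simp add: is_run_def)
  moreover have "(parikh_sum w i)(dim A := 0) = parikh_sum (\<lambda>i. (w i)(dim A := 0)) i" for i
    by (simp add: parikh_sum_def fun_eq_iff)
  moreover have "constraint_set (parity_PA A) = {x. x(dim A := 0) \<in> constraint_set A \<and>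
       (odd (x (dim A)) \<longleftrightarrow> initial A \<notin> accepting A)}"
    by (simp add: parity_PA_def)
  ultimately show ?thesis
    using p unfolding reach_reg_acc_def reach_acc_def by auto
qed

lemma reach_reg_lang_parity_PA:
  assumes A: "is_PA A"
  shows "reach_reg_lang (parity_PA A) = reach_lang A"
proof (intro set_eqI iffI)
  fix \<alpha> assume "\<alpha> \<in> reach_reg_lang (parity_PA A)"
  then show "\<alpha> \<in> reach_lang A"
    using A is_run_parity_PA[OF A] reach_reg_acc_parity_PA[OF A]
    unfolding reach_reg_lang_def reach_lang_def by auto blast
next
  fix \<alpha> assume "\<alpha> \<in> reach_lang A"
  then obtain p v where \<alpha>: "range \<alpha> \<subseteq> alphabet A"
    and run: "is_run A \<alpha> p v" and acc: "reach_acc A p v"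
    by (auto simp: reach_lang_def)
  \<comment> \<open>The only possible lift of the run: the state sequence dictates the new
    coordinate.\<close>
  define w where "w = (\<lambda>i. (v i)
    (dim A := of_bool ((p i \<in> accepting A) \<noteq> (p (Suc i) \<in> accepting A))))"
  have "v i \<in> nvecs (dim A)" for i
    using A run by (fastforce simp: is_PA_def is_run_def)
  then have v: "(\<lambda>i. (w i)(dim A := 0)) = v"
    by (auto simp: w_def nvecs_def fun_eq_iff)
  have run': "is_run (parity_PA A) \<alpha> p w"
    using run v by (simp add: is_run_parity_PA[OF A]) (simp add: w_def)
  then have "reach_reg_acc (parity_PA A) p w"
    using acc v by (simp add: reach_reg_acc_parity_PA[OF A])
  with \<alpha> run' show "\<alpha> \<in> reach_reg_lang (parity_PA A)"
    by (auto simp: reach_reg_lang_def)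
qed

section \<open>Runs of deterministic automata and their dependence on finite prefixes\<close>

lemma deterministic_run_exists:
  assumes A: "is_PA A" "deterministic A" and \<alpha>: "range \<alpha> \<subseteq> alphabet A"
  obtains p v where "is_run A \<alpha> p v"
proof -
  define step where "step = (\<lambda>q a. SOME vq. (q, a, vq) \<in> transitions A)"
  define p where "p = rec_nat (initial A) (\<lambda>i q. snd (step q (\<alpha> i)))"
  have step: "(q, \<alpha> i, step q (\<alpha> i)) \<in> transitions A" if "q \<in> states A" for q i
  proof -
    have "\<alpha> i \<in> alphabet A"
      using \<alpha> by blast
    then have "\<exists>vq. (q, \<alpha> i, vq) \<in> transitions A"
      using that A(2) unfolding deterministic_def by blast
    then show ?thesis
      unfolding step_def by (rule someI_ex)
  qed
  have p: "p 0 = initial A" "p (Suc i) = snd (step (p i) (\<alpha> i))" for i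
    by (simp_all add: p_def)
  \<comment> \<open>This invariant ensures that the choice in \<open>step\<close> is only made where
    a transition exists.\<close>
  have "p i \<in> states A" for i
  proof (induction i)
    case 0
    then show ?case using A(1) p by (simp add: is_PA_def)
  next
    case (Suc i)
    have "transitions A \<subseteq> states A \<times> alphabet A \<times> nvecs (dim A) \<times> states A"
      using A(1) by (simp add: is_PA_def)
    from subsetD[OF this step[OF Suc, of i]] show ?case
      by (simp add: p mem_Times_iff)
  qed
  then have "is_run A \<alpha> p (\<lambda>i. fst (step (p i) (\<alpha> i)))"
    using step by (simp add: is_run_def p)
  with that show thesis .
qed

lemma deterministic_step_unique:
  assumes "is_PA A" "deterministic A"
    and "(p, a, v, q) \<in> transitions A" "(p, a, v', q') \<in> transitions A"
  shows "v = v'" "q = q'"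
proof -
  have "\<exists>!vq. (p, a, vq) \<in> transitions A"
    using assms by (auto simp: is_PA_def deterministic_def)
  then show "v = v'" "q = q'"
    using assms(3,4) by auto
qed

lemma deterministic_runs_agree:
  assumes A: "is_PA A" "deterministic A"
    and run: "is_run A \<alpha> p v" "is_run A \<beta> p' v'"
    and eq: "\<And>k. k < n \<Longrightarrow> \<alpha> k = \<beta> k"
  shows "p n = p' n" and "k < n \<Longrightarrow> v k = v' k"
proof -
  have trans: "(p k, \<alpha> k, v k, p (Suc k)) \<in> transitions A"
    "(p' k, \<beta> k, v' k, p' (Suc k)) \<in> transitions A" for k
    using run by (simp_all add: is_run_def)
  \<comment> \<open>The bound includes \<open>n\<close>, since \<open>n\<close> letters determine
    \<open>n + 1\<close> states but only \<open>n\<close> vectors.\<close>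
  have state: "p k = p' k" if "k \<le> n" for k
    using that
  proof (induction k)
    case 0
    then show ?case using run by (simp add: is_run_def)
  next
    case (Suc k)
    then have "p k = p' k" "\<alpha> k = \<beta> k"
      using eq by simp_all
    then show ?case
      using deterministic_step_unique(2)[OF A trans(1)[of k]] trans(2)[of k] by simp
  qed
  show "p n = p' n"
    using state by simp
  show "v k = v' k" if "k < n"
    using deterministic_step_unique(1)[OF A trans(1)[of k]] trans(2)[of k] state[of k] eq that
    by simp
qed

text \<open>This is openness in the space of words over the alphabet. Acceptance is witnessed by the
  state and the vector sum after \<open>n\<close> letters; a word sharing these letters has some
  run, and that run has the same state and sum at \<open>n\<close>.\<close>

lemma deterministic_reach_lang_open:
  assumes A: "is_PA A" "deterministic A" and \<alpha>: "\<alpha> \<in> reach_lang A"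
  obtains n where
    "\<And>\<beta>. range \<beta> \<subseteq> alphabet A \<Longrightarrow> (\<And>k. k < n \<Longrightarrow> \<beta> k = \<alpha> k) \<Longrightarrow> \<beta> \<in> reach_lang A"
proof -
  obtain p v n where run: "is_run A \<alpha> p v"
    and acc: "n \<ge> 1" "p n \<in> accepting A" "parikh_sum v n \<in> constraint_set A"
    using \<alpha> by (auto simp: reach_lang_def reach_acc_def)
  show thesis
  proof (rule that)
    fix \<beta> assume \<beta>: "range \<beta> \<subseteq> alphabet A" and eq: "\<And>k. k < n \<Longrightarrow> \<beta> k = \<alpha> k"
    obtain p' v' where run': "is_run A \<beta> p' v'"
      using deterministic_run_exists[OF A \<beta>] .
    have "p' n = p n" "parikh_sum v' n = parikh_sum v n"
      using deterministic_runs_agree[OF A run' run eq] by (simp_all add: parikh_sum_def)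
    with run' acc have "reach_acc A p' v'"
      unfolding reach_acc_def by metis
    with \<beta> run' show "\<beta> \<in> reach_lang A"
      by (auto simp: reach_lang_def)
  qed
qed

section \<open>A separating language: infinitely many occurrences of a letter\<close>

text \<open>State 1 records that the last letter read was \<open>x\<close>. All vectors are zero, so
  every prefix meets the constraint and acceptance amounts to visiting state 1 infinitely
  often.\<close>

definition inf_often_PA :: "'a \<Rightarrow> 'a \<Rightarrow> (nat, 'a) parikh_automaton" where
  "inf_often_PA x y = \<lparr>
     dim = 1,
     states = {0, 1},
     alphabet = {x, y},
     initial = 0,
     transitions = (\<lambda>(p, a). (p, a, \<lambda>_. 0, of_bool (a = x))) ` ({0, 1} \<times> {x, y}),
     accepting = {1},
     constraint_set = {\<lambda>_. 0}\<rparr>"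

lemma is_PA_inf_often_PA: "is_PA (inf_often_PA x y)"
proof -
  have "semilinear 1 {\<lambda>_. 0}"
    unfolding semilinear_def
    by (intro exI[of _ "{(\<lambda>_. 0, {})}"]) (auto simp: nvecs_def linear_set_def)
  then show ?thesis
    by (auto simp: is_PA_def inf_often_PA_def nvecs_def)
qed

lemma deterministic_inf_often_PA: "deterministic (inf_often_PA x y)"
  by (auto simp: deterministic_def inf_often_PA_def image_iff)

lemma reach_reg_lang_inf_often_PA:
  fixes x y :: 'a
  shows "reach_reg_lang (inf_often_PA x y) = {\<alpha>. range \<alpha> \<subseteq> {x, y} \<and> infinite {j. \<alpha> j = x}}"
proof (intro set_eqI iffI)
  fix \<alpha> assume "\<alpha> \<in> reach_reg_lang (inf_often_PA x y)"
  then obtain p v where \<alpha>: "range \<alpha> \<subseteq> {x, y}" and run: "is_run (inf_often_PA x y) \<alpha> p v"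
    and acc: "infinite {j. j \<ge> 1 \<and> p j = 1}"
    by (auto simp: reach_reg_lang_def reach_reg_acc_def inf_often_PA_def)
  have "p (Suc j) = of_bool (\<alpha> j = x)" for j
    using run by (auto simp: is_run_def inf_often_PA_def)
  \<comment> \<open>The shift by one arises because letter \<open>j\<close> is recorded in state
    \<open>Suc j\<close>.\<close>
  then have "{j. j \<ge> 1 \<and> p j = 1} \<subseteq> Suc ` {j. \<alpha> j = x}"
    by (auto simp: image_iff gr0_conv_Suc Suc_le_eq of_bool_def split: if_splits)
  with acc \<alpha> show "\<alpha> \<in> {\<alpha>. range \<alpha> \<subseteq> {x, y} \<and> infinite {j. \<alpha> j = x}}"
    using finite_subset by blast
next
  fix \<alpha> :: "'a word" assume "\<alpha> \<in> {\<alpha>. range \<alpha> \<subseteq> {x, y} \<and> infinite {j. \<alpha> j = x}}"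
  then have \<alpha>: "range \<alpha> \<subseteq> {x, y}" and inf: "infinite {j. \<alpha> j = x}"
    by auto
  define p where "p = case_nat (0 :: nat) (\<lambda>j. of_bool (\<alpha> j = x))"
  have "p j \<in> {0, 1}" for j
    by (simp add: p_def split: nat.split)
  then have "is_run (inf_often_PA x y) \<alpha> p (\<lambda>_ _. 0)"
    using \<alpha> by (fastforce simp: is_run_def inf_often_PA_def p_def)
  moreover have "infinite {j. j \<ge> 1 \<and> p j = 1}"
  proof -
    have "Suc ` {j. \<alpha> j = x} \<subseteq> {j. j \<ge> 1 \<and> p j = 1}"
      by (auto simp: p_def)
    moreover have "infinite (Suc ` {j. \<alpha> j = x})"
      using inf by (simp add: finite_image_iff)
    ultimately show ?thesis
      using finite_subset by blast
  qed
  \<comment> \<open>An infinite set of visits is non-empty, which yields the index for the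
    reachability condition.\<close>
  moreover from this obtain i where "i \<ge> 1" "p i = 1"
    using not_finite_existsD by blast
  ultimately have "is_run (inf_often_PA x y) \<alpha> p (\<lambda>_ _. 0)"
    and "reach_reg_acc (inf_often_PA x y) p (\<lambda>_ _. 0)"
    by (auto simp: reach_reg_acc_def inf_often_PA_def parikh_sum_def)
  moreover have "alphabet (inf_often_PA x y) = {x, y}"
    by (simp add: inf_often_PA_def)
  ultimately show "\<alpha> \<in> reach_reg_lang (inf_often_PA x y)"
    using \<alpha> unfolding reach_reg_lang_def by auto
qed

text \<open>The language is not open at the constant word \<open>x\<close>: any finite prefix of it
  can be continued by \<open>y\<close> forever, leaving only finitely many \<open>x\<close>.\<close>

lemma reach_lang_not_inf_often:
  assumes A: "is_PA A" "deterministic A" and alph: "alphabet A = {x, y}" and "x \<noteq> y"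
  shows "reach_lang A \<noteq> {\<alpha>. range \<alpha> \<subseteq> {x, y} \<and> infinite {j. \<alpha> j = x}}"
proof
  assume L: "reach_lang A = {\<alpha>. range \<alpha> \<subseteq> {x, y} \<and> infinite {j. \<alpha> j = x}}"
  then have "(\<lambda>_. x) \<in> reach_lang A"
    by simp
  from deterministic_reach_lang_open[OF A this] obtain n where
    n: "\<And>\<beta>. range \<beta> \<subseteq> {x, y} \<Longrightarrow> (\<And>k. k < n \<Longrightarrow> \<beta> k = x) \<Longrightarrow> \<beta> \<in> reach_lang A"
    unfolding alph by blast
  have "(\<lambda>k. if k < n then x else y) \<in> reach_lang A"
    by (rule n) auto
  moreover have "{k. (if k < n then x else y) = x} = {..<n}"
    using \<open>x \<noteq> y\<close> by auto
  ultimately show False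
    unfolding L by simp
qed

section \<open>Comparison of the two classes\<close>

lemma det_reach_reg_languagesI:
  fixes A :: "(nat, 'a) parikh_automaton"
  assumes "is_PA A" "deterministic A"
  shows "(alphabet A, reach_reg_lang A) \<in> det_reach_reg_languages"
  unfolding det_reach_reg_languages_def
  by (rule CollectI, rule exI[of _ A]) (simp add: assms)

theorem lemma13:
  shows "(det_reach_languages :: ('a::infinite set \<times> 'a word set) set) \<subset> det_reach_reg_languages"
proof
  show "(det_reach_languages :: ('a set \<times> 'a word set) set) \<subseteq> det_reach_reg_languages"
  proof
    fix L :: "'a set \<times> 'a word set" assume "L \<in> det_reach_languages"
    then obtain A :: "(nat, 'a) parikh_automaton" where
      A: "is_PA A" "deterministic A" and "L = (alphabet A, reach_lang A)"
      by (auto simp: det_reach_languages_def)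
    then show "L \<in> det_reach_reg_languages"
      using det_reach_reg_languagesI[OF is_PA_parity_PA[OF A(1)] deterministic_parity_PA[OF A]]
      by (simp add: reach_reg_lang_parity_PA)
  qed
  \<comment> \<open>An infinite letter type has a letter other than \<open>undefined\<close>, which
    serves as an arbitrary first letter.\<close>
  obtain x y :: 'a where "x \<noteq> y"
    using ex_new_if_finite[OF infinite_UNIV, of "{undefined}"] by auto
  let ?L = "({x, y}, {\<alpha>. range \<alpha> \<subseteq> {x, y} \<and> infinite {j. \<alpha> j = x}})"
  have "?L \<in> det_reach_reg_languages"
    using det_reach_reg_languagesI[OF is_PA_inf_often_PA deterministic_inf_often_PA, of x y]
    unfolding reach_reg_lang_inf_often_PA by (simp add: inf_often_PA_def)
  moreover have "?L \<notin> det_reach_languages"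
  proof
    assume "?L \<in> det_reach_languages"
    then obtain A :: "(nat, 'a) parikh_automaton" where A: "is_PA A" "deterministic A"
      and L: "?L = (alphabet A, reach_lang A)"
      by (auto simp: det_reach_languages_def)
    \<comment> \<open>Pairing languages with alphabets makes \<open>A\<close> read \<open>y\<close>
      as well, so the continuation by \<open>y\<close> is a word over its alphabet.\<close>
    have alph: "alphabet A = {x, y}"
      using L by simp
    have "reach_lang A = {\<alpha>. range \<alpha> \<subseteq> {x, y} \<and> infinite {j. \<alpha> j = x}}"
      using arg_cong[OF L, of snd] unfolding snd_conv by (rule sym)
    with reach_lang_not_inf_often[OF A alph \<open>x \<noteq> y\<close>] show False
      by contradiction
  qed
  ultimately show "(det_reach_languages :: ('a set \<times> 'a word set) set) \<noteq> det_reach_reg_languages"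
    by blast
qed

end
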